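(* Let $\mathcal E$ be a circle of radius $r$ contained inside a circle $\mathcal B$ of radius $R$ in the Euclidean plane. Let $d$ be the distance between the centres of $\mathcal E$ and $\mathcal B$. The sole necessary and sufficient condition for the existence of a triangle circumscribed about $\mathcal E$ and inscribed in $\mathcal B$ is $$d^2\le R(R-2r).$$
   Context: "Contained inside $\mathcal B$" means contained in the closed disc bounded by $\mathcal B$. The terms "circumscribed about" and "inscribed in" are used in their usual sense in Euclidean geometry.
   Formalization: "Circumscribed about E" is read as: the closed triangular region contains E, without requiring the sides to be tangent; with tangency the claim fails, e.g. R = 1, r = 1/10, d = 0, since such a triangle forces d² = R(R−2r). *)

theory Defs
  imports "HOL-Analysis.Analysis"
begin

definition is_triangle :: "real ^ 2 \<Rightarrow> real ^ 2 \<Rightarrow> real ^ 2 \<Rightarrow> bool" where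
  "is_triangle u v w \<longleftrightarrow> \<not> collinear {u, v, w}"

definition triangle_inscribed_in ::
    "real ^ 2 \<Rightarrow> real ^ 2 \<Rightarrow> real ^ 2 \<Rightarrow> (real ^ 2) set \<Rightarrow> bool" where
  "triangle_inscribed_in u v w B \<longleftrightarrow> u \<in> B \<and> v \<in> B \<and> w \<in> B"

text \<open>
  ``Circumscribed about'' means drawn around: the closed triangular region contains the circle.
  Tangency of all three sides is deliberately not demanded. If a triangle has its vertices on
  a circle of radius R and its sides tangent to an inner circle of radius r, the
  Chapple--Euler formula forces d^2 = R(R - 2r), so under that reading
  the inequality d^2 <= R(R - 2r) would not be a sufficient condition.
\<close>

definition triangle_circumscribed_about ::
    "real ^ 2 \<Rightarrow> real ^ 2 \<Rightarrow> real ^ 2 \<Rightarrow> (real ^ 2) set \<Rightarrow> bool" where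
  "triangle_circumscribed_about u v w E \<longleftrightarrow> E \<subseteq> convex hull {u, v, w}"

end

theory Submission
  imports Defs
begin

text \<open>
  Necessity: let \<open>a\<close>, \<open>b\<close>, \<open>c\<close> be the side lengths, \<open>S\<close> the area, and \<open>x\<close>, \<open>y\<close>, \<open>z\<close> the distances
  from the centre \<open>p\<close> of the inner circle to the sides.  Expressing the power of \<open>p\<close> in barycentric
  coordinates and using \<open>a b c = 4 R S\<close> gives \<open>R\<^sup>2 - d\<^sup>2 = (R / S) (c x y + a y z + b z x)\<close>.
  As \<open>x, y, z \<ge> r\<close>, the triangle inequality bounds the last factor below by
  \<open>r (a x + b y + c z) = 2 r S\<close>.

  Sufficiency: the isosceles triangle with apex on the line of centres and base tangent to the
  circle about \<open>p\<close> of radius \<open>(R\<^sup>2 - d\<^sup>2) / (2 R) \<ge> r\<close> has that circle as its incircle.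
\<close>

section \<open>Signed areas and collinearity in the plane\<close>

text \<open>Twice the signed area of the triangle, positive for counterclockwise order.\<close>

definition cross2 :: "real ^ 2 \<Rightarrow> real ^ 2 \<Rightarrow> real ^ 2 \<Rightarrow> real" where
  "cross2 u v w = (v$1 - u$1) * (w$2 - u$2) - (v$2 - u$2) * (w$1 - u$1)"

lemma cross2_rotate: "cross2 v w u = cross2 u v w"
  by (simp add: cross2_def algebra_simps)

lemma cross2_swap: "cross2 u w v = - cross2 u v w"
  by (simp add: cross2_def algebra_simps)

lemma dist_vec2_squared:
  fixes x y :: "real ^ 2"
  shows "(dist x y)\<^sup>2 = (x$1 - y$1)\<^sup>2 + (x$2 - y$2)\<^sup>2"
  by (simp add: dist_norm norm_vec_def L2_set_def sum_2)

lemma collinear_iff_cross2: "collinear {u, v, w} \<longleftrightarrow> cross2 u v w = 0"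
proof -
  have "collinear {u, v, w} \<longleftrightarrow> collinear {0, v - u, w - u}"
    using collinear_3[of v u w] by (simp add: insert_commute)
  also have "\<dots> \<longleftrightarrow> cross2 u v w = 0"
  proof
    assume "collinear {0, v - u, w - u}"
    then consider "v - u = 0" | "w - u = 0" | c where "w - u = c *\<^sub>R (v - u)"
      by (auto simp: collinear_lemma)
    then show "cross2 u v w = 0"
    proof cases
      case 3
      then have "w$1 - u$1 = c * (v$1 - u$1)" "w$2 - u$2 = c * (v$2 - u$2)"
        by (auto simp: vec_eq_iff)
      then show ?thesis by (simp add: cross2_def)
    qed (auto simp: cross2_def)
  next
    assume 0: "cross2 u v w = 0"
    show "collinear {0, v - u, w - u}"
    proof (cases "v = u")
      case False
      define s where "s = (v$1 - u$1)\<^sup>2 + (v$2 - u$2)\<^sup>2"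
      \<comment> \<open>The coefficient of the orthogonal projection of \<open>w - u\<close> onto
        \<open>v - u\<close>; a vanishing cross product makes that projection all of
        \<open>w - u\<close>.\<close>
      define c where "c = ((v$1 - u$1) * (w$1 - u$1) + (v$2 - u$2) * (w$2 - u$2)) / s"
      have s: "s \<noteq> 0" using False
        by (auto simp: s_def vec_eq_iff forall_2 sum_power2_eq_zero_iff)
      have "s * (w$1 - u$1) = ((v$1 - u$1) * (w$1 - u$1) + (v$2 - u$2) * (w$2 - u$2)) * (v$1 - u$1)"
           "s * (w$2 - u$2) = ((v$1 - u$1) * (w$1 - u$1) + (v$2 - u$2) * (w$2 - u$2)) * (v$2 - u$2)"
        using 0 unfolding s_def cross2_def by algebra+
      then have "w$1 - u$1 = c * (v$1 - u$1)" "w$2 - u$2 = c * (v$2 - u$2)"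
        using s by (auto simp: c_def field_simps)
      then have "w - u = c *\<^sub>R (v - u)"
        by (simp add: vec_eq_iff forall_2)
      then show ?thesis
        by (auto simp: collinear_lemma)
    qed simp
  qed
  finally show ?thesis .
qed

text \<open>The point of the circle farthest out across the line \<open>v w\<close> still lies in
  the triangle, hence on the inner side of that line. So \<open>p\<close> is at distance at least
  \<open>r\<close> from the side.\<close>

lemma cross2_ge_of_sphere_subset_hull:
  assumes r: "0 \<le> r" and D: "0 < cross2 u v w"
    and sub: "sphere p r \<subseteq> convex hull {u, v, w}"
  shows "r * dist v w \<le> cross2 p v w"
proof -
  define a where "a = dist v w"
  have "v \<noteq> w" using D by (auto simp: cross2_def algebra_simps)
  then have a: "0 < a" by (simp add: a_def)
  have a2: "a\<^sup>2 = (v$1 - w$1)\<^sup>2 + (v$2 - w$2)\<^sup>2"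
    by (simp add: a_def dist_vec2_squared)
  \<comment> \<open>With positive orientation, \<open>w - v\<close> turned clockwise by a right
    angle is the outward normal of this side.\<close>
  define z :: "real ^ 2" where
    "z = vector [p$1 + r / a * (w$2 - v$2), p$2 - r / a * (w$1 - v$1)]"
  have z: "z$1 = p$1 + r / a * (w$2 - v$2)" "z$2 = p$2 - r / a * (w$1 - v$1)"
    by (simp_all add: z_def)
  have "(dist p z)\<^sup>2 = (r / a)\<^sup>2 * a\<^sup>2"
    unfolding dist_vec2_squared z a2 by algebra
  also have "\<dots> = r\<^sup>2" using a by (simp add: power_divide)
  finally have "dist p z = r" using r by (simp add: power2_eq_iff_nonneg)
  then have "z \<in> convex hull {u, v, w}" using sub by auto
  then obtain k l m where klm: "0 \<le> k" "0 \<le> l" "0 \<le> m" "k + l + m = 1"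
    "z = k *\<^sub>R u + l *\<^sub>R v + m *\<^sub>R w"
    by (auto simp: convex_hull_3)
  have k: "k = 1 - l - m" using klm by simp
  have "cross2 z v w = k * cross2 u v w"
    unfolding cross2_def klm(5) k by (simp add: algebra_simps)
  then have "0 \<le> cross2 z v w" using klm D by simp
  also have "cross2 z v w = cross2 p v w - r / a * a\<^sup>2"
    unfolding cross2_def z a2 by algebra
  also have "\<dots> = cross2 p v w - r * a" using a by (simp add: power2_eq_square)
  finally show ?thesis by (simp add: a_def)
qed

section \<open>Barycentric coordinates and metric identities for inscribed triangles\<close>

lemma barycentric_cross2:
  "cross2 u v w *\<^sub>R p = cross2 p v w *\<^sub>R u + cross2 p w u *\<^sub>R v + cross2 p u v *\<^sub>R w"
  by (simp add: vec_eq_iff forall_2 cross2_def algebra_simps)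

lemma cross2_sum: "cross2 p v w + cross2 p w u + cross2 p u v = cross2 u v w"
  by (simp add: cross2_def algebra_simps)

text \<open>Take the circumcentre as origin and expand the squared norm of the barycentric
  combination. Each \<open>2 * (u' \<bullet> v')\<close> equals
  \<open>2 * R\<^sup>2 - (dist u v)\<^sup>2\<close>, and the \<open>R\<^sup>2\<close> terms collect
  to \<open>(X + Y + Z)\<^sup>2 * R\<^sup>2\<close>.\<close>

lemma power_of_point_barycentric:
  fixes p q u v w :: "'a::real_inner"
  assumes on: "dist q u = R" "dist q v = R" "dist q w = R"
    and bary: "(X + Y + Z) *\<^sub>R p = X *\<^sub>R u + Y *\<^sub>R v + Z *\<^sub>R w"
  shows "(X + Y + Z)\<^sup>2 * (R\<^sup>2 - (dist p q)\<^sup>2)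
    = X * Y * (dist u v)\<^sup>2 + Y * Z * (dist v w)\<^sup>2 + Z * X * (dist w u)\<^sup>2"
proof -
  define u' v' w' p' where d: "u' = u - q" "v' = v - q" "w' = w - q" "p' = p - q"
  have uu: "u' \<bullet> u' = R\<^sup>2" "v' \<bullet> v' = R\<^sup>2" "w' \<bullet> w' = R\<^sup>2"
    using on by (simp_all add: d dist_norm norm_minus_commute flip: power2_norm_eq_inner)
  have "(X + Y + Z) *\<^sub>R p' = X *\<^sub>R u' + Y *\<^sub>R v' + Z *\<^sub>R w'"
    using bary by (simp add: d algebra_simps)
  then have "((X + Y + Z) *\<^sub>R p') \<bullet> ((X + Y + Z) *\<^sub>R p')
    = (X *\<^sub>R u' + Y *\<^sub>R v' + Z *\<^sub>R w') \<bullet> (X *\<^sub>R u' + Y *\<^sub>R v' + Z *\<^sub>R w')"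
    by simp
  then have 1: "(X + Y + Z)\<^sup>2 * (p' \<bullet> p') = X\<^sup>2 * R\<^sup>2 + Y\<^sup>2 * R\<^sup>2 + Z\<^sup>2 * R\<^sup>2
    + 2 * X * Y * (u' \<bullet> v') + 2 * Y * Z * (v' \<bullet> w') + 2 * Z * X * (w' \<bullet> u')"
    by (simp add: inner_add_left inner_add_right uu inner_commute power2_eq_square algebra_simps)
  have "dist u v = norm (u' - v')" "dist v w = norm (v' - w')" "dist w u = norm (w' - u')"
    "dist p q = norm p'"
    by (simp_all add: d dist_norm)
  then have "(dist u v)\<^sup>2 = 2 * R\<^sup>2 - 2 * (u' \<bullet> v')" "(dist v w)\<^sup>2 = 2 * R\<^sup>2 - 2 * (v' \<bullet> w')"
    "(dist w u)\<^sup>2 = 2 * R\<^sup>2 - 2 * (w' \<bullet> u')" "(dist p q)\<^sup>2 = p' \<bullet> p'"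
    by (simp_all add: power2_norm_eq_inner inner_diff_left inner_diff_right uu inner_commute)
  then show ?thesis using 1 by algebra
qed

text \<open>This is \<open>a b c = 4 R S\<close>. In terms of the inner products \<open>A\<close>,
  \<open>B\<close>, \<open>C\<close> of the vectors from the centre to the vertices, the squares of
  the two sides differ by a multiple of a Gram determinant, which vanishes in the plane.\<close>

lemma circumradius_formula:
  assumes on: "dist q u = R" "dist q v = R" "dist q w = R"
  shows "dist u v * dist v w * dist w u = 2 * R * \<bar>cross2 u v w\<bar>"
proof -
  have R: "0 \<le> R" using on by auto
  define x1 y1 x2 y2 x3 y3 where
    d: "x1 = u$1 - q$1" "y1 = u$2 - q$2" "x2 = v$1 - q$1" "y2 = v$2 - q$2"
       "x3 = w$1 - q$1" "y3 = w$2 - q$2"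
  have e: "x1\<^sup>2 + y1\<^sup>2 = R\<^sup>2" "x2\<^sup>2 + y2\<^sup>2 = R\<^sup>2" "x3\<^sup>2 + y3\<^sup>2 = R\<^sup>2"
    using on[THEN arg_cong[where f = "\<lambda>x. x\<^sup>2"]]
    by (simp_all add: d dist_vec2_squared power2_commute)
  define A B C where A: "A = x1 * x2 + y1 * y2" and B: "B = x2 * x3 + y2 * y3"
    and C: "C = x3 * x1 + y3 * y1"
  have s: "(dist u v)\<^sup>2 = 2 * (R\<^sup>2 - A)" "(dist v w)\<^sup>2 = 2 * (R\<^sup>2 - B)"
    "(dist w u)\<^sup>2 = 2 * (R\<^sup>2 - C)"
  proof -
    have "(dist u v)\<^sup>2 = (x1 - x2)\<^sup>2 + (y1 - y2)\<^sup>2" "(dist v w)\<^sup>2 = (x2 - x3)\<^sup>2 + (y2 - y3)\<^sup>2"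
      "(dist w u)\<^sup>2 = (x3 - x1)\<^sup>2 + (y3 - y1)\<^sup>2"
      by (simp_all add: dist_vec2_squared d)
    then show "(dist u v)\<^sup>2 = 2 * (R\<^sup>2 - A)" "(dist v w)\<^sup>2 = 2 * (R\<^sup>2 - B)"
      "(dist w u)\<^sup>2 = 2 * (R\<^sup>2 - C)"
      using e unfolding A B C by algebra+
  qed
  define c12 c23 c31 where c: "c12 = x1 * y2 - y1 * x2" "c23 = x2 * y3 - y2 * x3"
    "c31 = x3 * y1 - y3 * x1"
  \<comment> \<open>Lagrange's identity for the squares, and its polarized form for the products in
    \<open>pr\<close>.\<close>
  have sq: "c12\<^sup>2 = R\<^sup>2 * R\<^sup>2 - A\<^sup>2" "c23\<^sup>2 = R\<^sup>2 * R\<^sup>2 - B\<^sup>2" "c31\<^sup>2 = R\<^sup>2 * R\<^sup>2 - C\<^sup>2"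
    unfolding c A B C using e by algebra+
  have pr: "c12 * c23 = A * B - C * R\<^sup>2" "c23 * c31 = B * C - A * R\<^sup>2" "c31 * c12 = C * A - B * R\<^sup>2"
    unfolding c A B C using e by algebra+
  have "cross2 u v w = c12 + c23 + c31"
    by (simp add: cross2_def d c algebra_simps)
  then have D2: "(cross2 u v w)\<^sup>2 = 3 * (R\<^sup>2 * R\<^sup>2) - A\<^sup>2 - B\<^sup>2 - C\<^sup>2
      + 2 * (A * B + B * C + C * A) - 2 * (A + B + C) * R\<^sup>2"
    using sq pr by algebra
  \<comment> \<open>Vanishing of the Gram determinant of three vectors in the plane.\<close>
  have "(R\<^sup>2 * R\<^sup>2 - A\<^sup>2) * (R\<^sup>2 * R\<^sup>2 - B\<^sup>2) = (A * B - C * R\<^sup>2)\<^sup>2"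
    by (simp only: power_mult_distrib flip: sq pr)
  then have "R\<^sup>2 * (R\<^sup>2 * R\<^sup>2 * R\<^sup>2 + 2 * A * B * C - R\<^sup>2 * (A\<^sup>2 + B\<^sup>2 + C\<^sup>2)) = 0"
    if "R \<noteq> 0" using that by algebra
  \<comment> \<open>The factor \<open>R\<^sup>2\<close> cancels only for
    \<open>R \<noteq> 0\<close>; otherwise the Gram identity reads
    \<open>2 * A * B * C = 0\<close>.\<close>
  moreover have "A = 0" if "R = 0"
    using e that by (simp add: A sum_power2_eq_zero_iff)
  ultimately have gram: "R\<^sup>2 * R\<^sup>2 * R\<^sup>2 + 2 * A * B * C = R\<^sup>2 * (A\<^sup>2 + B\<^sup>2 + C\<^sup>2)"
    by (cases "R = 0") auto
  have "2 * (R\<^sup>2 - A) * (2 * (R\<^sup>2 - B)) * (2 * (R\<^sup>2 - C)) = 4 * R\<^sup>2 * (cross2 u v w)\<^sup>2"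
    using gram unfolding D2 by algebra
  then have "(dist u v * dist v w * dist w u)\<^sup>2 = (2 * R * \<bar>cross2 u v w\<bar>)\<^sup>2"
    by (simp add: power_mult_distrib s)
  then show ?thesis
    using R by (simp add: power2_eq_iff_nonneg)
qed

section \<open>Necessity of the inequality\<close>

text \<open>In terms of the excesses \<open>x - r\<close>, \<open>y - r\<close>,
  \<open>z - r\<close> the \<open>r\<^sup>2\<close> terms cancel, and the difference of the two
  sides is a sum of nonnegative products.\<close>

lemma inscribed_triangle_inequality:
  fixes a b c x y z r :: real
  assumes "0 \<le> r" "r \<le> x" "r \<le> y" "r \<le> z" "a \<le> b + c" "b \<le> c + a" "c \<le> a + b"
    and pos: "0 \<le> a" "0 \<le> b" "0 \<le> c"
  shows "r * (a * x + b * y + c * z) \<le> c * x * y + a * y * z + b * z * x"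
proof -
  have "0 \<le> r * ((b + c - a) * (x - r) + (c + a - b) * (y - r) + (a + b - c) * (z - r))
      + c * (x - r) * (y - r) + a * (y - r) * (z - r) + b * (z - r) * (x - r)"
    using assms by (intro add_nonneg_nonneg mult_nonneg_nonneg) auto
  then show ?thesis by (simp add: algebra_simps)
qed

lemma chapple_euler_le_of_pos:
  assumes r: "0 < r" and R: "0 < R" and D: "0 < cross2 u v w"
    and sub: "sphere p r \<subseteq> convex hull {u, v, w}"
    and on: "dist q u = R" "dist q v = R" "dist q w = R"
  shows "(dist p q)\<^sup>2 \<le> R * (R - 2 * r)"
proof -
  define a b c where abc: "a = dist v w" "b = dist w u" "c = dist u v"
  define D where "D = cross2 u v w"
  have ne: "u \<noteq> v" "v \<noteq> w" "w \<noteq> u"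
    using D by (auto simp: cross2_def algebra_simps)
  then have pos: "0 < a" "0 < b" "0 < c" by (auto simp: abc)
  have tri: "a \<le> b + c" "b \<le> c + a" "c \<le> a + b"
    unfolding abc by (metis add.commute dist_commute dist_triangle)+
  \<comment> \<open>Signed distances from \<open>p\<close> to the sides: twice the area over the
    base.\<close>
  define x y z where xyz: "x = cross2 p v w / a" "y = cross2 p w u / b" "z = cross2 p u v / c"
  have X: "cross2 p v w = a * x" "cross2 p w u = b * y" "cross2 p u v = c * z"
    using pos by (auto simp: xyz)
  have "r * a \<le> a * x"
    using cross2_ge_of_sphere_subset_hull[OF _ D sub] r by (simp add: X abc)
  moreover have "r * b \<le> b * y"
    using cross2_ge_of_sphere_subset_hull[of r v w u p] r D sub
    by (simp add: X abc cross2_rotate insert_commute)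
  moreover have "r * c \<le> c * z"
    using cross2_ge_of_sphere_subset_hull[of r w u v p] r D sub
    by (simp add: X abc cross2_rotate[of w u v] cross2_rotate[of v w u] insert_commute)
  ultimately have ge: "r \<le> x" "r \<le> y" "r \<le> z"
    using pos by (auto simp: mult.commute[of r])
  have sum: "a * x + b * y + c * z = D"
    using cross2_sum[of p v w u] by (simp add: X D_def)
  have "(a * x + b * y + c * z) *\<^sub>R p = (a * x) *\<^sub>R u + (b * y) *\<^sub>R v + (c * z) *\<^sub>R w"
    using barycentric_cross2[of u v w p] by (simp add: sum X flip: D_def)
  then have "D\<^sup>2 * (R\<^sup>2 - (dist p q)\<^sup>2)
      = (a * x) * (b * y) * c\<^sup>2 + (b * y) * (c * z) * a\<^sup>2 + (c * z) * (a * x) * b\<^sup>2"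
    using power_of_point_barycentric[OF on, of "a * x" "b * y" "c * z" p]
    unfolding sum unfolding abc by simp
  also have "\<dots> = (a * b * c) * (c * x * y + a * y * z + b * z * x)"
    by (simp add: power2_eq_square algebra_simps)
  also have "\<dots> \<ge> (a * b * c) * (r * (a * x + b * y + c * z))"
    using inscribed_triangle_inequality[OF _ ge tri] r pos by (intro mult_left_mono) auto
  also have "a * b * c = 2 * R * D"
    using circumradius_formula[OF on] D by (simp add: abc D_def mult_ac)
  finally have "D\<^sup>2 * (2 * R * r) \<le> D\<^sup>2 * (R\<^sup>2 - (dist p q)\<^sup>2)"
    unfolding sum by (simp add: power2_eq_square mult_ac)
  then have "2 * R * r \<le> R\<^sup>2 - (dist p q)\<^sup>2"
    using D by (simp add: D_def)
  then show ?thesis by (simp add: power2_eq_square algebra_simps)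
qed

text \<open>Exchanging two vertices reduces to the counterclockwise case.\<close>

lemma chapple_euler_le:
  fixes p q u v w :: "real ^ 2"
  assumes r: "0 < r" and R: "0 < R" and D: "\<not> collinear {u, v, w}"
    and sub: "sphere p r \<subseteq> convex hull {u, v, w}"
    and on: "dist q u = R" "dist q v = R" "dist q w = R"
  shows "(dist p q)\<^sup>2 \<le> R * (R - 2 * r)"
proof (cases "0 < cross2 u v w")
  case True
  then show ?thesis using chapple_euler_le_of_pos assms by blast
next
  case False
  then have "0 < cross2 u w v"
    using D by (simp add: collinear_iff_cross2 cross2_swap[of u w v])
  moreover have "sphere p r \<subseteq> convex hull {u, w, v}"
    using sub by (simp add: insert_commute)
  ultimately show ?thesis using chapple_euler_le_of_pos r R on by blast
qed

section \<open>Sufficiency: the isosceles triangle\<close>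

text \<open>Coordinates have \<open>q\<close> at the origin and \<open>p\<close> at
  \<open>(d, 0)\<close>; the apex is \<open>(R, 0)\<close> and the base vertices are
  \<open>(x0, h)\<close> and \<open>(x0, -h)\<close>. The conclusions place \<open>(s, t)\<close> on
  the inner side of the base and of both legs.\<close>

lemma disc_in_isosceles_triangle:
  fixes s t R d r x0 h :: real
  assumes R: "0 < R" and d: "0 \<le> d" "d < R" and r: "0 \<le> r" "2 * R * r \<le> R\<^sup>2 - d\<^sup>2"
    and x0: "2 * R * x0 = (R + d)\<^sup>2 - 2 * R\<^sup>2" and h: "h\<^sup>2 = R\<^sup>2 - x0\<^sup>2" "0 < h" "x0 < R"
    and st: "(s - d)\<^sup>2 + t\<^sup>2 = r\<^sup>2"
  shows "x0 \<le> s" "\<bar>t\<bar> * (R - x0) \<le> h * (R - s)"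
proof -
  have "\<bar>s - d\<bar> \<le> r"
    using st r by (metis abs_le_square_iff abs_of_nonneg le_add_same_cancel1 zero_le_power2)
  then have "R * (d - r) \<le> R * s" using R by (intro mult_left_mono) auto
  then have "R * x0 \<le> R * s"
    using r x0 by (simp add: power2_eq_square algebra_simps)
  then show "x0 \<le> s" using R by simp
  \<comment> \<open>Lagrange's identity, used as Cauchy-Schwarz for the leg normal
    \<open>(h, R - x0)\<close>, whose squared length is \<open>2 * R * (R - x0)\<close>.\<close>
  have "(h * (s - d) + \<bar>t\<bar> * (R - x0))\<^sup>2 + (h * \<bar>t\<bar> - (s - d) * (R - x0))\<^sup>2
      = (h\<^sup>2 + (R - x0)\<^sup>2) * ((s - d)\<^sup>2 + \<bar>t\<bar>\<^sup>2)"
    by algebra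
  also have "\<dots> = 2 * R * (R - x0) * r\<^sup>2"
    unfolding power2_abs st h by (simp add: power2_eq_square algebra_simps)
  finally have "2 * R * (h * (s - d) + \<bar>t\<bar> * (R - x0))\<^sup>2 \<le> 2 * R * (2 * R * (R - x0) * r\<^sup>2)"
    using R by (intro mult_left_mono) (smt (verit) zero_le_power2, simp)
  also have "\<dots> = (R - x0) * (2 * R * r)\<^sup>2" by algebra
  also have "\<dots> \<le> (R - x0) * (R\<^sup>2 - d\<^sup>2)\<^sup>2"
    using h R r by (intro mult_left_mono power_mono) auto
  \<comment> \<open>Equivalently, the legs are at distance
    \<open>(R\<^sup>2 - d\<^sup>2) / (2 * R)\<close> from \<open>p\<close>, just like the
    base.\<close>
  also have "\<dots> = 2 * R * (h * (R - d))\<^sup>2"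
    using x0 h(1) by algebra
  finally have "(h * (s - d) + \<bar>t\<bar> * (R - x0))\<^sup>2 \<le> (h * (R - d))\<^sup>2"
    using R by simp
  then have "h * (s - d) + \<bar>t\<bar> * (R - x0) \<le> h * (R - d)"
    by (rule power2_le_imp_le) (use h d in auto)
  then show "\<bar>t\<bar> * (R - x0) \<le> h * (R - s)" by (simp add: algebra_simps)
qed

lemma exists_inscribed_triangle:
  fixes p q :: "real ^ 2"
  assumes r: "0 < r" and R: "0 < R" and le: "(dist p q)\<^sup>2 \<le> R * (R - 2 * r)"
  obtains u v w where "\<not> collinear {u, v, w}" "sphere p r \<subseteq> convex hull {u, v, w}"
    "dist q u = R" "dist q v = R" "dist q w = R"
proof -
  define d where "d = dist p q"
  have d0: "0 \<le> d" by (simp add: d_def)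
  have rR: "2 * R * r \<le> R\<^sup>2 - d\<^sup>2"
    using le by (simp add: d_def power2_eq_square algebra_simps)
  moreover have "0 < 2 * R * r" using r R by simp
  ultimately have "d\<^sup>2 < R\<^sup>2" by linarith
  then have dR: "d < R" using R by (simp add: power2_less_imp_less)
  \<comment> \<open>A unit vector from \<open>q\<close> towards \<open>p\<close>; for concentric
    circles any direction works, and \<open>(1, 0)\<close> is taken.\<close>
  obtain e1 e2 where e: "e1\<^sup>2 + e2\<^sup>2 = 1" "p$1 = q$1 + d * e1" "p$2 = q$2 + d * e2"
  proof (cases "d = 0")
    case True
    then show ?thesis using that[of 1 0] by (simp add: d_def)
  next
    case False
    have "((p$1 - q$1) / d)\<^sup>2 + ((p$2 - q$2) / d)\<^sup>2 = (dist p q)\<^sup>2 / d\<^sup>2"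
      by (simp add: dist_vec2_squared power_divide add_divide_distrib)
    with False show ?thesis
      by (intro that[of "(p$1 - q$1) / d" "(p$2 - q$2) / d"]) (auto simp: d_def)
  qed
  \<comment> \<open>Equal to \<open>d - (R\<^sup>2 - d\<^sup>2) / (2 * R)\<close>, so that the base
    is tangent to the intended incircle.\<close>
  define x0 where "x0 = ((R + d)\<^sup>2 - 2 * R\<^sup>2) / (2 * R)"
  have x0: "2 * R * x0 = (R + d)\<^sup>2 - 2 * R\<^sup>2" using R by (simp add: x0_def)
  have "(R + d)\<^sup>2 < (2 * R)\<^sup>2" using d0 dR by (intro power_strict_mono) auto
  then have "2 * R * x0 < 2 * R * R" using x0 by (simp add: power2_eq_square)
  then have x0R: "x0 < R" using R by simp
  have "0 < (R + d)\<^sup>2" using R d0 by simp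
  then have "2 * R * (-R) < 2 * R * x0" using x0 by (simp add: power2_eq_square)
  then have x0R': "-R < x0" using R mult_less_cancel_left_pos[of "2 * R" "-R" x0] by simp
  define h where "h = sqrt (R\<^sup>2 - x0\<^sup>2)"
  have "x0\<^sup>2 < R\<^sup>2" using x0R x0R' using power_strict_mono[of "\<bar>x0\<bar>" R 2] by auto
  then have h: "h\<^sup>2 = R\<^sup>2 - x0\<^sup>2" "0 < h" by (auto simp: h_def)
  \<comment> \<open>\<open>P s t\<close> has coordinates \<open>(s, t)\<close> in the orthonormal
    frame at \<open>q\<close> with first axis \<open>(e1, e2)\<close>.\<close>
  define P :: "real \<Rightarrow> real \<Rightarrow> real ^ 2" where
    "P s t = vector [q$1 + s * e1 - t * e2, q$2 + s * e2 + t * e1]" for s t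
  have P: "P s t $ 1 = q$1 + s * e1 - t * e2" "P s t $ 2 = q$2 + s * e2 + t * e1" for s t
    by (simp_all add: P_def)
  have distP: "dist q (P s t) = R" if "s\<^sup>2 + t\<^sup>2 = R\<^sup>2" for s t
  proof -
    have "(dist q (P s t))\<^sup>2 = R\<^sup>2"
      using e(1) that unfolding dist_vec2_squared P by algebra
    then show ?thesis using R by (simp add: power2_eq_iff_nonneg)
  qed
  have "cross2 (P R 0) (P x0 h) (P x0 (-h)) = 2 * h * (R - x0)"
    using e(1) unfolding cross2_def P by algebra
  then have "\<not> collinear {P R 0, P x0 h, P x0 (-h)}"
    using h x0R by (simp add: collinear_iff_cross2)
  moreover have "sphere p r \<subseteq> convex hull {P R 0, P x0 h, P x0 (-h)}"
  proof
    fix z assume "z \<in> sphere p r"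
    then have "(dist p z)\<^sup>2 = r\<^sup>2" by simp
    then have z: "(p$1 - z$1)\<^sup>2 + (p$2 - z$2)\<^sup>2 = r\<^sup>2" by (simp add: dist_vec2_squared)
    define s where "s = (z$1 - q$1) * e1 + (z$2 - q$2) * e2"
    define t where "t = (z$2 - q$2) * e1 - (z$1 - q$1) * e2"
    have zP: "z$1 = q$1 + s * e1 - t * e2" "z$2 = q$2 + s * e2 + t * e1"
      using e(1) unfolding s_def t_def by algebra+
    have "(s - d)\<^sup>2 + t\<^sup>2 = r\<^sup>2"
      using z e(1) unfolding e(2,3) zP by algebra
    note b = disc_in_isosceles_triangle[OF R d0 dR less_imp_le[OF r] rR x0 h x0R this]
    \<comment> \<open>Barycentric coordinates of \<open>z\<close>: the position between base and
      apex fixes \<open>k\<close>, and \<open>t\<close> fixes how \<open>1 - k\<close> splits into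
      \<open>l\<close> and \<open>m\<close>.\<close>
    define k where "k = (s - x0) / (R - x0)"
    define l where "l = ((R - s) / (R - x0) + t / h) / 2"
    define m where "m = ((R - s) / (R - x0) - t / h) / 2"
    have "\<bar>t\<bar> / h \<le> (R - s) / (R - x0)"
      using b h x0R by (simp add: field_simps)
    then have "\<bar>t / h\<bar> \<le> (R - s) / (R - x0)" using h by simp
    then have "0 \<le> l" "0 \<le> m" by (simp_all add: l_def m_def abs_le_iff del: abs_divide)
    moreover have "0 \<le> k" using b x0R by (simp add: k_def)
    moreover have sum_lm: "l + m = (R - s) / (R - x0)"
      unfolding l_def m_def by argo
    then have sum1: "k + (l + m) = 1"
      using x0R unfolding k_def sum_lm by (simp flip: add_divide_distrib)
    moreover have "z = k *\<^sub>R P R 0 + l *\<^sub>R P x0 h + m *\<^sub>R P x0 (-h)"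
    proof -
      have "l - m = t / h" unfolding l_def m_def by argo
      then have lm: "l + m = 1 - k" "(l - m) * h = t" "k * (R - x0) = s - x0"
        using x0R h sum1 by (simp, simp, simp add: k_def)
      have "z$1 = k * (P R 0)$1 + l * (P x0 h)$1 + m * (P x0 (-h))$1"
           "z$2 = k * (P R 0)$2 + l * (P x0 h)$2 + m * (P x0 (-h))$2"
        using lm unfolding zP P by algebra+
      then show ?thesis by (simp add: vec_eq_iff forall_2)
    qed
    ultimately show "z \<in> convex hull {P R 0, P x0 h, P x0 (-h)}"
      by (auto simp: convex_hull_3 add.assoc)
  qed
  ultimately show ?thesis
    using h by (intro that[of "P R 0" "P x0 h" "P x0 (-h)"] distP) auto
qed

theorem corollary2:
  fixes p q :: "real ^ 2" and r R d :: real
  assumes "0 < r" and "0 < R"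
    and "sphere p r \<subseteq> cball q R"
    and "d = dist p q"
  shows "(\<exists>u v w. is_triangle u v w \<and> triangle_circumscribed_about u v w (sphere p r)
            \<and> triangle_inscribed_in u v w (sphere q R))
         \<longleftrightarrow> d\<^sup>2 \<le> R * (R - 2 * r)"
  (is "?ex \<longleftrightarrow> _")
proof
  assume ?ex
  then show "d\<^sup>2 \<le> R * (R - 2 * r)"
    using chapple_euler_le[OF assms(1,2)]
    by (auto simp: is_triangle_def triangle_circumscribed_about_def triangle_inscribed_in_def
        assms(4))
next
  assume "d\<^sup>2 \<le> R * (R - 2 * r)"
  then obtain u v w where "\<not> collinear {u, v, w}" "sphere p r \<subseteq> convex hull {u, v, w}"
    "dist q u = R" "dist q v = R" "dist q w = R"
    using exists_inscribed_triangle[OF assms(1,2)] unfolding assms(4) by blast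
  then show ?ex
    by (auto simp: is_triangle_def triangle_circumscribed_about_def triangle_inscribed_in_def)
qed

end
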